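(* Let $d_e,d_r,n_f,l_f$ be positive integers with $l_f\le d_e$, and put $l_m=d_e-l_f+1$. Let $\mathbf{H}\in\mathbb{R}^{n_fl_f\times d_r}$ and $\mathbf{W}\in\mathbb{R}^{n_fl_m\times d_e}$ be the parameters of a HypER model. Consider the LowFER model with factorization rank $k=d_e$, entity embedding dimension $d_e$, relation embedding dimension $d_r$ and $\mathbf{U}=[\,\mathbf{I}_{d_e}\,|\,\cdots\,|\,\mathbf{I}_{d_e}\,]\in\mathbb{R}^{d_e\times d_e^2}$ ($d_e$ identity blocks). Then there exists $\mathbf{V}\in\mathbb{R}^{d_r\times d_e^2}$ such that LowFER represents HypER up to the non-linearity, i.e. for all $\mathbf{e}_s,\mathbf{e}_o\in\mathbb{R}^{d_e}$ and $\mathbf{r}\in\mathbb{R}^{d_r}$, $$\bigl(\mathbf{S}^k\,\mathrm{diag}(\mathbf{U}^T\mathbf{e}_s)\,\mathbf{V}^T\mathbf{r}\bigr)^T\mathbf{e}_o=\mathrm{vec}(\mathbf{e}_s*\mathbf{F}_r)\,\mathbf{W}\,\mathbf{e}_o,\qquad \mathbf{F}_r=\mathrm{vec}^{-1}(\mathbf{H}\mathbf{r}).$$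
   Context: HypER model. The HypER score is $\phi_h(e_s,r,e_o)=h\bigl(\mathrm{vec}(\mathbf{e}_s*\mathbf{F}_r)\mathbf{W}\bigr)\mathbf{e}_o$, where $h$ is the ReLU non-linearity applied entrywise; "up to the non-linearity" means with $h$ omitted. Here $\mathbf{F}_r=\mathrm{vec}^{-1}(\mathbf{H}\mathbf{r})\in\mathbb{R}^{n_f\times l_f}$ is the matrix of $n_f$ relation-specific filters of length $l_f$; $\mathrm{vec}$ turns an $n\times m$ matrix into a (row) vector of length $nm$ (say row by row) and $\mathrm{vec}^{-1}$ is the reverse reshaping. The 1D convolution $\mathbf{e}_s*\mathbf{F}_r\in\mathbb{R}^{n_f\times l_m}$ applies each filter to $\mathbf{e}_s$ with output length $l_m=d_e-l_f+1$: $(\mathbf{e}_s*\mathbf{F}_r)_{a,b}=\sum_{c=1}^{l_f}(\mathbf{F}_r)_{a,c}(\mathbf{e}_s)_{b+c-1}$. LowFER model. With rank $k$ and parameters $\mathbf{U}\in\mathbb{R}^{d_e\times kd_e}$, $\mathbf{V}\in\mathbb{R}^{d_r\times kd_e}$, the LowFER score is $\bigl(\mathbf{S}^k\,\mathrm{diag}(\mathbf{U}^T\mathbf{e}_s)\,\mathbf{V}^T\mathbf{r}\bigr)^T\mathbf{e}_o$, where $\mathbf{S}^k\in\mathbb{R}^{d_e\times kd_e}$ has $\mathbf{S}^k_{i,j}=1$ if $(i-1)k+1\le j\le ik$ and $0$ otherwise. *)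

theory Defs
  imports Complex_Main "Jordan_Normal_Form.Matrix"
begin

(* All indices are 0-based; dimensions are carried explicitly by the vectors and matrices. *)

definition vec_of_mat :: "'a mat \<Rightarrow> 'a vec" where
  "vec_of_mat A = vec (dim_row A * dim_col A)
     (\<lambda>t. A $$ (t div dim_col A, t mod dim_col A))"

definition mat_of_vec :: "nat \<Rightarrow> nat \<Rightarrow> 'a vec \<Rightarrow> 'a mat" where
  "mat_of_vec n m v = mat n m (\<lambda>(i, j). v $ (i * m + j))"

lemma mat_of_vec_of_mat:
  assumes "A \<in> carrier_mat n m"
  shows "mat_of_vec n m (vec_of_mat A) = A"
proof (rule eq_matI)
  fix i j assume "i < dim_row A" "j < dim_col A"
  then have ij: "i < n" "j < m" using assms by auto
  have "i * m + j < Suc i * m" using ij by simp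
  also have "\<dots> \<le> n * m" using ij by (intro mult_le_mono1) simp
  finally show "mat_of_vec n m (vec_of_mat A) $$ (i, j) = A $$ (i, j)"
    using assms ij by (simp add: mat_of_vec_def vec_of_mat_def)
qed (use assms in \<open>auto simp: mat_of_vec_def\<close>)

definition conv1d :: "real vec \<Rightarrow> real mat \<Rightarrow> real mat" where
  "conv1d e F = mat (dim_row F) (dim_vec e - dim_col F + 1)
     (\<lambda>(a, b). \<Sum>c<dim_col F. F $$ (a, c) * e $ (b + c))"

definition hyper_filters :: "nat \<Rightarrow> nat \<Rightarrow> real mat \<Rightarrow> real vec \<Rightarrow> real mat" where
  "hyper_filters nf lf H r = mat_of_vec nf lf (H *\<^sub>v r)"

(* The HypER score with the ReLU omitted.
   The row-vector product vec(e_s * F_r) W is written as transpose_mat W times a column vector. *)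
definition hyper_linear_score ::
  "nat \<Rightarrow> nat \<Rightarrow> real mat \<Rightarrow> real mat \<Rightarrow> real vec \<Rightarrow> real vec \<Rightarrow> real vec \<Rightarrow> real" where
  "hyper_linear_score nf lf H W es r eo =
     (transpose_mat W *\<^sub>v vec_of_mat (conv1d es (hyper_filters nf lf H r))) \<bullet> eo"

definition diag_of_vec :: "real vec \<Rightarrow> real mat" where
  "diag_of_vec v = mat_diag (dim_vec v) (\<lambda>i. v $ i)"

(* 0-based form of: S(i,j) = 1 iff (i-1)k+1 <= j <= ik. *)
definition lowfer_S :: "nat \<Rightarrow> nat \<Rightarrow> real mat" where
  "lowfer_S k d = mat d (k * d) (\<lambda>(i, j). if i * k \<le> j \<and> j < (i + 1) * k then 1 else 0)"

definition lowfer_score ::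
  "nat \<Rightarrow> nat \<Rightarrow> real mat \<Rightarrow> real mat \<Rightarrow> real vec \<Rightarrow> real vec \<Rightarrow> real vec \<Rightarrow> real" where
  "lowfer_score k d U V es r eo =
     ((lowfer_S k d * diag_of_vec (transpose_mat U *\<^sub>v es) * transpose_mat V) *\<^sub>v r) \<bullet> eo"

(* The block row [I_d | ... | I_d] with k blocks: column j is column (j mod d) of the block. *)
definition repeated_identity :: "nat \<Rightarrow> nat \<Rightarrow> real mat" where
  "repeated_identity k d = mat d (k * d) (\<lambda>(i, j). 1\<^sub>m d $$ (i, j mod d))"

end

(* Both scores are the inner product of eo with a vector that is bilinear in es and r.
   For k = d and U a row of identity blocks, coordinate i of the LowFER vector is
   sum_p es_p (V^T r)_(i d + p), so the block of V belonging to i is a free linear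
   function of r for every p. Collecting the coefficient of es_p in the convolution, where
   es_p meets output position b through the filter entry p - b, gives V. *)
theory Submission
  imports Defs
begin

lemma block_index_less:
  fixes i p k d :: nat
  assumes "i < d" "p < k"
  shows "i * k + p < k * d"
proof -
  have "i * k + p < Suc i * k" using assms by simp
  also have "\<dots> \<le> d * k" using assms by (intro mult_le_mono1) simp
  finally show ?thesis by (simp add: mult.commute)
qed

lemma diag_of_vec_mult_vec:
  assumes "u \<in> carrier_vec n" "w \<in> carrier_vec n"
  shows "diag_of_vec u *\<^sub>v w = vec n (\<lambda>j. u $ j * w $ j)"
proof (rule eq_vecI)
  fix j assume "j < dim_vec (vec n (\<lambda>j. u $ j * w $ j))"
  then have j: "j < n" by simp
  have "(diag_of_vec u *\<^sub>v w) $ j = (\<Sum>l<n. (if j = l then u $ l else 0) * w $ l)"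
    using j assms
    by (auto simp: diag_of_vec_def mat_diag_def scalar_prod_def lessThan_atLeast0)
  also have "\<dots> = (\<Sum>l<n. if j = l then u $ l * w $ l else 0)"
    by (intro sum.cong) auto
  also have "\<dots> = u $ j * w $ j" using j by simp
  finally show "(diag_of_vec u *\<^sub>v w) $ j = vec n (\<lambda>j. u $ j * w $ j) $ j" using j by simp
qed (use assms in \<open>auto simp: diag_of_vec_def mat_diag_def\<close>)

text \<open>Row \<open>i\<close> of \<open>lowfer_S k d\<close> is the indicator of the
  \<open>i\<close>-th run of \<open>k\<close> consecutive indices, so the product is sum pooling
  with window \<open>k\<close>.\<close>

lemma lowfer_S_mult_vec:
  assumes "w \<in> carrier_vec (k * d)"
  shows "lowfer_S k d *\<^sub>v w = vec d (\<lambda>i. \<Sum>p<k. w $ (i * k + p))"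
proof (rule eq_vecI)
  fix i assume "i < dim_vec (vec d (\<lambda>i. \<Sum>p<k. w $ (i * k + p)))"
  then have i: "i < d" by simp
  \<comment> \<open>The whole window lies inside the index range, so restricting the sum to it loses
    no term.\<close>
  have le: "(i + 1) * k \<le> k * d"
    using i by (metis Suc_eq_plus1 Suc_leI mult.commute mult_le_mono1)
  have "(lowfer_S k d *\<^sub>v w) $ i
      = (\<Sum>j<k * d. if j \<in> {i * k..<(i + 1) * k} then w $ j else 0)"
    using i assms
    by (auto simp: lowfer_S_def scalar_prod_def lessThan_atLeast0 intro!: sum.cong)
  also have "\<dots> = (\<Sum>j\<in>{i * k..<(i + 1) * k}. w $ j)"
    using le by (subst sum.inter_restrict[symmetric]) (auto intro!: sum.cong)
  also have "\<dots> = (\<Sum>p<k. w $ (i * k + p))"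
    using sum.shift_bounds_nat_ivl[of "\<lambda>j. w $ j" 0 "i * k" k]
    by (simp add: lessThan_atLeast0 add.commute)
  finally show "(lowfer_S k d *\<^sub>v w) $ i = vec d (\<lambda>i. \<Sum>p<k. w $ (i * k + p)) $ i"
    using i by simp
qed (simp add: lowfer_S_def)

lemma transpose_repeated_identity_mult_vec:
  assumes "e \<in> carrier_vec d" "d > 0"
  shows "transpose_mat (repeated_identity k d) *\<^sub>v e = vec (k * d) (\<lambda>j. e $ (j mod d))"
proof (rule eq_vecI)
  fix j assume "j < dim_vec (vec (k * d) (\<lambda>j. e $ (j mod d)))"
  then have j: "j < k * d" by simp
  have m: "j mod d < d" using assms by simp
  have "(transpose_mat (repeated_identity k d) *\<^sub>v e) $ j
      = (\<Sum>l<d. if l = j mod d then e $ l else 0)"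
    using j m assms
    by (simp add: repeated_identity_def scalar_prod_def lessThan_atLeast0
      if_distrib[of "\<lambda>x. x * _"] cong: if_cong)
  also have "\<dots> = e $ (j mod d)" using m by simp
  finally show "(transpose_mat (repeated_identity k d) *\<^sub>v e) $ j
      = vec (k * d) (\<lambda>j. e $ (j mod d)) $ j" using j by simp
qed (simp add: repeated_identity_def)

text \<open>This is where \<open>k = d\<close> matters: the pooling windows coincide with the
  identity blocks. Since \<open>(i * d + p) mod d = p\<close>, offset \<open>p\<close> of every
  window carries the factor \<open>es $ p\<close>.\<close>

lemma lowfer_score_repeated_identity:
  assumes V: "V \<in> carrier_mat m (d * d)" and es: "es \<in> carrier_vec d"
    and r: "r \<in> carrier_vec m" and d: "d > 0"
  shows "lowfer_score d d (repeated_identity d d) V es r eo =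
    vec d (\<lambda>i. \<Sum>p<d. es $ p * (transpose_mat V *\<^sub>v r) $ (i * d + p)) \<bullet> eo"
proof -
  define u where "u = transpose_mat (repeated_identity d d) *\<^sub>v es"
  have u: "u = vec (d * d) (\<lambda>j. es $ (j mod d))"
    unfolding u_def using es d by (rule transpose_repeated_identity_mult_vec)
  have uc: "u \<in> carrier_vec (d * d)" by (simp add: u)
  have S: "lowfer_S d d \<in> carrier_mat d (d * d)" by (simp add: lowfer_S_def)
  have D: "diag_of_vec u \<in> carrier_mat (d * d) (d * d)"
    using uc by (simp add: diag_of_vec_def mat_diag_def)
  have VT: "transpose_mat V \<in> carrier_mat (d * d) m" using V by simp
  have Vr: "transpose_mat V *\<^sub>v r \<in> carrier_vec (d * d)" using VT r by simp
  \<comment> \<open>Reassociating to the right turns the matrix product into an entrywise product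
    followed by pooling.\<close>
  have "(lowfer_S d d * diag_of_vec u * transpose_mat V) *\<^sub>v r
      = lowfer_S d d *\<^sub>v (diag_of_vec u *\<^sub>v (transpose_mat V *\<^sub>v r))"
    using assoc_mult_mat_vec[OF mult_carrier_mat[OF S D] VT r] assoc_mult_mat_vec[OF S D Vr]
    by simp
  also have "\<dots> = vec d (\<lambda>i. \<Sum>p<d. es $ p * (transpose_mat V *\<^sub>v r) $ (i * d + p))"
    unfolding diag_of_vec_mult_vec[OF uc Vr]
    by (subst lowfer_S_mult_vec) (auto simp: u block_index_less intro!: eq_vecI sum.cong)
  finally show ?thesis by (simp add: lowfer_score_def u_def)
qed

text \<open>The flattening is row-major: \<open>t div lm\<close> is the filter and
  \<open>t mod lm\<close> the output position, and the filters are themselves rows of length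
  \<open>lf\<close> in \<open>H *\<^sub>v r\<close>.\<close>

lemma hyper_linear_score_eq:
  assumes W: "W \<in> carrier_mat (nf * lm) d" and es: "es \<in> carrier_vec d"
    and lf: "lf \<le> d" and lm: "lm = d - lf + 1"
  shows "hyper_linear_score nf lf H W es r eo =
    vec d (\<lambda>i. \<Sum>t<nf * lm. W $$ (t, i) *
      (\<Sum>c<lf. (H *\<^sub>v r) $ (t div lm * lf + c) * es $ (t mod lm + c))) \<bullet> eo"
proof -
  have pos: "lm > 0" using lm by simp
  have "t div lm < nf" if "t < nf * lm" for t
    using that by (simp add: less_mult_imp_div_less)
  then show ?thesis
    unfolding hyper_linear_score_def
    using W es lm pos
    by (intro arg_cong2[of _ _ _ _ "(\<bullet>)"] refl eq_vecI)
       (auto simp: vec_of_mat_def conv1d_def hyper_filters_def mat_of_vec_def scalar_prod_def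
         lessThan_atLeast0 intro!: sum.cong)
qed

text \<open>Substitute \<open>p = b + c\<close> and extend the filter by zero. The range of
  \<open>p\<close> no longer depends on the position \<open>b\<close>, so this sum can be
  interchanged with the sum over output positions.\<close>

lemma sum_filter_window:
  fixes f g :: "nat \<Rightarrow> 'a::comm_semiring_0"
  assumes "b + l \<le> n"
  shows "(\<Sum>c<l. f c * g (b + c)) =
    (\<Sum>p<n. g p * (if b \<le> p \<and> p < b + l then f (p - b) else 0))"
proof -
  have "(\<Sum>p<n. g p * (if b \<le> p \<and> p < b + l then f (p - b) else 0))
      = (\<Sum>p<n. if p \<in> {b..<b + l} then g p * f (p - b) else 0)"
    by (intro sum.cong) auto
  also have "\<dots> = (\<Sum>p\<in>{b..<b + l}. g p * f (p - b))"
    using assms by (subst sum.inter_restrict[symmetric]) (auto intro!: sum.cong)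
  also have "\<dots> = (\<Sum>c<l. f c * g (b + c))"
    using sum.shift_bounds_nat_ivl[of "\<lambda>p. g p * f (p - b)" 0 b l]
    by (simp add: lessThan_atLeast0 add.commute mult.commute)
  finally show ?thesis ..
qed

text \<open>Column \<open>j\<close> encodes the pair of output coordinate \<open>i = j div d\<close>
  and input coordinate \<open>p = j mod d\<close>; the entry is the coefficient of
  \<open>r $ q * es $ p\<close> in coordinate \<open>i\<close> of the HypER vector. The guard
  expresses the zero extension of the filter and keeps the truncated subtraction exact.\<close>

definition hyper_lowfer_V :: "nat \<Rightarrow> nat \<Rightarrow> nat \<Rightarrow> nat \<Rightarrow> nat \<Rightarrow> real mat \<Rightarrow> real mat \<Rightarrow> real mat"
  where
  "hyper_lowfer_V m d nf lf lm H W = mat m (d * d) (\<lambda>(q, j). \<Sum>t<nf * lm. W $$ (t, j div d) *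
     (if t mod lm \<le> j mod d \<and> j mod d < t mod lm + lf
      then H $$ (t div lm * lf + (j mod d - t mod lm), q) else 0))"

text \<open>The entries of the witness are linear in \<open>H\<close> and the guard does not depend
  on \<open>q\<close>, so summing against \<open>r\<close> replaces each entry of \<open>H\<close>
  by an entry of \<open>H *\<^sub>v r\<close>.\<close>

lemma transpose_hyper_lowfer_V_mult_vec:
  assumes H: "H \<in> carrier_mat (nf * lf) m" and r: "r \<in> carrier_vec m"
    and i: "i < d" and p: "p < d"
  shows "(transpose_mat (hyper_lowfer_V m d nf lf lm H W) *\<^sub>v r) $ (i * d + p) =
    (\<Sum>t<nf * lm. W $$ (t, i) * (if t mod lm \<le> p \<and> p < t mod lm + lf
      then (H *\<^sub>v r) $ (t div lm * lf + (p - t mod lm)) else 0))"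
    (is "_ = (\<Sum>t<_. W $$ (t, i) * ?F t)")
proof -
  let ?G = "\<lambda>t q. if t mod lm \<le> p \<and> p < t mod lm + lf
      then H $$ (t div lm * lf + (p - t mod lm), q) else 0"
  have j: "i * d + p < d * d" using i p by (rule block_index_less)
  have "(transpose_mat (hyper_lowfer_V m d nf lf lm H W) *\<^sub>v r) $ (i * d + p)
      = (\<Sum>q<m. (\<Sum>t<nf * lm. W $$ (t, i) * ?G t q) * r $ q)"
    using j r p
    by (auto simp: hyper_lowfer_V_def scalar_prod_def lessThan_atLeast0 intro!: sum.cong)
  also have "\<dots> = (\<Sum>q<m. \<Sum>t<nf * lm. W $$ (t, i) * (?G t q * r $ q))"
    by (simp only: sum_distrib_right mult.assoc)
  also have "\<dots> = (\<Sum>t<nf * lm. W $$ (t, i) * (\<Sum>q<m. ?G t q * r $ q))"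
    by (subst sum.swap) (simp only: sum_distrib_left)
  also have "\<dots> = (\<Sum>t<nf * lm. W $$ (t, i) * ?F t)"
  proof (intro sum.cong refl arg_cong2[of _ _ _ _ "(*)"])
    fix t assume "t \<in> {..<nf * lm}"
    then have "t div lm < nf" by (simp add: less_mult_imp_div_less)
    then have "t div lm * lf + c < nf * lf" if "c < lf" for c
      using block_index_less[of "t div lm" nf c lf] that by (simp add: mult.commute)
    \<comment> \<open>Inside the window the filter offset is below \<open>lf\<close>, so this is a
      genuine row of \<open>H\<close> and the entry of \<open>H *\<^sub>v r\<close> unfolds to a
      scalar product.\<close>
    then have row: "t div lm * lf + (p - t mod lm) < nf * lf"
      if "t mod lm \<le> p \<and> p < t mod lm + lf"
      using that by (metis less_diff_conv2 add.commute)
    show "(\<Sum>q<m. ?G t q * r $ q) = ?F t"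
    proof (cases "t mod lm \<le> p \<and> p < t mod lm + lf")
      case True
      then show ?thesis
        using row H r by (auto simp: scalar_prod_def lessThan_atLeast0 intro!: sum.cong)
    qed auto
  qed
  finally show ?thesis .
qed

theorem mainTheorem4:
  fixes de dr nf lf lm k :: nat and H W U :: "real mat"
  assumes "de > 0" and "dr > 0" and "nf > 0" and "lf > 0" and "lf \<le> de"
    and "lm = de - lf + 1"
    and "H \<in> carrier_mat (nf * lf) dr"
    and "W \<in> carrier_mat (nf * lm) de"
    and "k = de"
    and "U = repeated_identity k de"
  shows "\<exists>V \<in> carrier_mat dr (k * de).
    \<forall>es \<in> carrier_vec de. \<forall>eo \<in> carrier_vec de. \<forall>r \<in> carrier_vec dr.
      lowfer_score k de U V es r eo = hyper_linear_score nf lf H W es r eo"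
proof (intro bexI ballI)
  let ?V = "hyper_lowfer_V dr de nf lf lm H W"
  have V: "?V \<in> carrier_mat dr (de * de)" by (simp add: hyper_lowfer_V_def)
  then show "?V \<in> carrier_mat dr (k * de)" using assms by simp
  fix es eo r :: "real vec"
  assume es: "es \<in> carrier_vec de" and "eo \<in> carrier_vec de" and r: "r \<in> carrier_vec dr"
  let ?F = "\<lambda>t p. if t mod lm \<le> p \<and> p < t mod lm + lf
      then (H *\<^sub>v r) $ (t div lm * lf + (p - t mod lm)) else 0"
  \<comment> \<open>Both scores pair a vector with \<open>eo\<close>, so it suffices to compare
    coordinates. Moving the sum over \<open>p\<close> inside leaves, for each fixed
    \<open>t\<close>, one zero-extended window sum.\<close>
  have coord: "(\<Sum>p<de. es $ p * (transpose_mat ?V *\<^sub>v r) $ (i * de + p)) =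
      (\<Sum>t<nf * lm. W $$ (t, i) *
        (\<Sum>c<lf. (H *\<^sub>v r) $ (t div lm * lf + c) * es $ (t mod lm + c)))"
    if i: "i < de" for i
  proof -
    have "(\<Sum>p<de. es $ p * (transpose_mat ?V *\<^sub>v r) $ (i * de + p))
        = (\<Sum>p<de. es $ p * (\<Sum>t<nf * lm. W $$ (t, i) * ?F t p))"
      by (intro sum.cong refl)
        (simp only: transpose_hyper_lowfer_V_mult_vec[OF assms(7) r i] lessThan_iff)
    also have "\<dots> = (\<Sum>p<de. \<Sum>t<nf * lm. W $$ (t, i) * (es $ p * ?F t p))"
      by (simp only: sum_distrib_left mult.left_commute)
    also have "\<dots> = (\<Sum>t<nf * lm. W $$ (t, i) * (\<Sum>p<de. es $ p * ?F t p))"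
      by (subst sum.swap) (simp only: sum_distrib_left)
    also have "\<dots> = (\<Sum>t<nf * lm. W $$ (t, i) *
        (\<Sum>c<lf. (H *\<^sub>v r) $ (t div lm * lf + c) * es $ (t mod lm + c)))"
    proof (rule sum.cong[OF refl], rule arg_cong2[of _ _ _ _ "(*)", OF refl])
      fix t
      have "t mod lm < lm" using assms(6) by simp
      \<comment> \<open>The last output position is \<open>lm - 1 = de - lf\<close>, whose window
        ends exactly at \<open>de\<close>.\<close>
      then have "t mod lm + lf \<le> de" using assms(5,6) by linarith
      then show "(\<Sum>p<de. es $ p * ?F t p) =
          (\<Sum>c<lf. (H *\<^sub>v r) $ (t div lm * lf + c) * es $ (t mod lm + c))"
        by (rule sum_filter_window[symmetric])
    qed
    finally show ?thesis .
  qed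
  have "lowfer_score de de (repeated_identity de de) ?V es r eo =
      hyper_linear_score nf lf H W es r eo"
    unfolding lowfer_score_repeated_identity[OF V es r assms(1)]
      hyper_linear_score_eq[OF assms(8) es assms(5,6)]
    by (intro arg_cong2[of _ _ _ _ "(\<bullet>)"] refl eq_vecI) (simp_all add: coord)
  then show "lowfer_score k de U ?V es r eo = hyper_linear_score nf lf H W es r eo"
    using assms(9,10) by simp
qed

end
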